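(* Let $p$ and $q$ be monic real-rooted polynomials of degree $n$, each with simple roots, having a common interlacer and having distinct roots (no root of $p$ is a root of $q$). Let $\lambda_1>\dots>\lambda_n$ be the roots of $p$ and $\mu_1>\dots>\mu_n$ the roots of $q$. If $p \succeq q$ (that is, $p$ majorizes $q$), then $$\sum_{i=1}^{k} \frac{p(\mu_i)}{q'(\mu_i)} < 0 \qquad \text{for all integers } 1\le k<n.$$
   Context: Roots are always listed in nonincreasing order. Majorization: for real vectors $a_1\ge\dots\ge a_n$ and $b_1\ge\dots\ge b_n$, $a\succeq b$ means $\sum_{i=1}^k a_i\ge\sum_{i=1}^k b_i$ for all $k\le n$ and $\sum_{i=1}^n a_i=\sum_{i=1}^n b_i$. For real-rooted polynomials of degree $n$ with ordered root vectors $\lambda$ (of $p$) and $\mu$ (of $q$), $p\succeq q$ ($p$ majorizes $q$) means $\lambda\succeq\mu$. Common interlacer: $p$ and $q$ have a common interlacer if there is a third polynomial interlacing both; explicitly, the closed intervals with endpoints $\lambda_i,\mu_i$ ($1\le i\le n$) are non-crossing, i.e. $\max(\lambda_{i+1},\mu_{i+1})\le\min(\lambda_i,\mu_i)$ for $1\le i<n$. *)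

theory Defs
  imports "HOL-Analysis.Analysis" "HOL-Computational_Algebra.Computational_Algebra"
begin

text \<open>All complex roots are real; this excludes the zero polynomial, of which every complex number
  is a root.\<close>

definition real_rooted :: "real poly \<Rightarrow> bool" where
  "real_rooted p \<longleftrightarrow> (\<forall>z::complex. poly (map_poly of_real p) z = 0 \<longrightarrow> z \<in> \<real>)"

text \<open>The \<open>i\<close>-th largest root, counted from \<open>1\<close> and with multiplicity. For real-rooted \<open>p\<close> it is
  meaningful for \<open>1 \<le> i \<le> degree p\<close>.\<close>

definition ordered_root :: "real poly \<Rightarrow> nat \<Rightarrow> real" where
  "ordered_root p i = rev (sorted_list_of_multiset (proots p)) ! (i - 1)"

text \<open>The vectors \<open>a\<close> and \<open>b\<close> have entries \<open>1..n\<close> and are understood to be nonincreasing.\<close>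

definition majorizes :: "nat \<Rightarrow> (nat \<Rightarrow> real) \<Rightarrow> (nat \<Rightarrow> real) \<Rightarrow> bool" where
  "majorizes n a b \<longleftrightarrow>
     (\<forall>k\<in>{1..n}. (\<Sum>i=1..k. a i) \<ge> (\<Sum>i=1..k. b i)) \<and> (\<Sum>i=1..n. a i) = (\<Sum>i=1..n. b i)"

definition poly_majorizes :: "real poly \<Rightarrow> real poly \<Rightarrow> bool" where
  "poly_majorizes p q \<longleftrightarrow>
     degree p = degree q \<and> majorizes (degree p) (ordered_root p) (ordered_root q)"

text \<open>The roots of \<open>r\<close>, one fewer than those of \<open>p\<close>, alternate weakly with the roots of \<open>p\<close>.\<close>

definition interlaces :: "real poly \<Rightarrow> real poly \<Rightarrow> bool" where
  "interlaces r p \<longleftrightarrow>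
     real_rooted r \<and> real_rooted p \<and> degree p = degree r + 1 \<and>
     (\<forall>i\<in>{1..degree r}. ordered_root p (i + 1) \<le> ordered_root r i \<and>
                         ordered_root r i \<le> ordered_root p i)"

definition common_interlacer :: "real poly \<Rightarrow> real poly \<Rightarrow> bool" where
  "common_interlacer p q \<longleftrightarrow> (\<exists>r. interlaces r p \<and> interlaces r q)"

lemma poly_map_poly_of_real_mult:
  "poly (map_poly of_real (p * q)) (z::complex) =
     poly (map_poly of_real p) z * poly (map_poly of_real q) z"
proof -
  have add: "poly (map_poly of_real (a + b)) z =
      poly (map_poly of_real a) z + poly (map_poly of_real b) z" for a b :: "real poly"
  proof -
    have "map_poly (of_real :: real \<Rightarrow> complex) (a + b) = map_poly of_real a + map_poly of_real b"
      by (rule poly_eqI) (simp add: coeff_map_poly)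
    then show ?thesis by simp
  qed
  have smult: "poly (map_poly of_real (smult c a)) z = of_real c * poly (map_poly of_real a) z"
    for c and a :: "real poly"
  proof -
    have "map_poly (of_real :: real \<Rightarrow> complex) (smult c a) = smult (of_real c) (map_poly of_real a)"
      by (rule poly_eqI) (simp add: coeff_map_poly)
    then show ?thesis by simp
  qed
  show ?thesis
  proof (induction p)
    case (pCons a p)
    have "map_poly (of_real :: real \<Rightarrow> complex) (pCons 0 (p * q)) = pCons 0 (map_poly of_real (p * q))"
      "map_poly (of_real :: real \<Rightarrow> complex) (pCons a p) = pCons (of_real a) (map_poly of_real p)"
      by (rule poly_eqI, simp add: coeff_map_poly coeff_pCons split: nat.split)+
    with pCons show ?case
      by (simp add: add smult algebra_simps)
  qed simp
qed

lemma poly_map_poly_of_real: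
  "poly (map_poly of_real p) (of_real x :: complex) = of_real (poly p x)"
proof (induction p)
  case (pCons a p)
  have "map_poly (of_real :: real \<Rightarrow> complex) (pCons a p) = pCons (of_real a) (map_poly of_real p)"
    by (rule poly_eqI, simp add: coeff_map_poly coeff_pCons split: nat.split)
  with pCons show ?case by simp
qed simp

lemma real_rooted_nonzero: "real_rooted p \<Longrightarrow> p \<noteq> 0"
proof
  assume "real_rooted p" "p = 0"
  then have "\<i> \<in> \<real>" unfolding real_rooted_def by simp
  then show False by (simp add: complex_is_Real_iff)
qed

lemma size_proots_real_rooted:
  assumes "real_rooted p"
  shows "size (proots p) = degree p"
  using assms
proof (induction "degree p" arbitrary: p)
  case 0
  then show ?case using size_proots_le[of p] by simp
next
  case (Suc d)
  have "degree (map_poly (of_real :: real \<Rightarrow> complex) p) = degree p"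
    by (rule degree_map_poly) simp
  with Suc.hyps have "\<not> constant (poly (map_poly (of_real :: real \<Rightarrow> complex) p))"
    by (simp add: constant_degree)
  then obtain z :: complex where z: "poly (map_poly of_real p) z = 0"
    using fundamental_theorem_of_algebra by blast
  with Suc.prems obtain x where "z = of_real x"
    by (auto simp: real_rooted_def Reals_def)
  with z have "poly p x = 0" by (simp add: poly_map_poly_of_real)
  then obtain q where q: "p = [:-x, 1:] * q" by (auto simp: poly_eq_0_iff_dvd)
  have nz: "q \<noteq> 0" using real_rooted_nonzero[OF Suc.prems] q by auto
  have rq: "real_rooted q"
    using Suc.prems unfolding q real_rooted_def poly_map_poly_of_real_mult by simp
  have dp: "degree p = Suc (degree q)" unfolding q using nz by (subst degree_mult_eq) auto
  with Suc.hyps rq have "size (proots q) = degree q" by simp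
  moreover have "proots p = {#x#} + proots q" unfolding q using nz by (subst proots_mult) auto
  ultimately show ?case using dp by simp
qed

lemma ordered_root_mset:
  assumes "sorted_wrt (\<ge>) xs" "proots p = mset xs"
  shows "rev (sorted_list_of_multiset (proots p)) = xs"
proof -
  have "sorted (rev xs)" using assms by (simp add: sorted_wrt_rev)
  then have "sorted_list_of_multiset (mset (rev xs)) = rev xs"
    by (simp only: sorted_list_of_multiset_mset sort_key_id_if_sorted sorted_sort_id)
  with assms show ?thesis by simp
qed

lemma ordered_root_antimono:
  assumes "real_rooted p" "1 \<le> i" "i \<le> j" "j \<le> degree p"
  shows "ordered_root p j \<le> ordered_root p i"
proof -
  let ?xs = "rev (sorted_list_of_multiset (proots p))"
  have len: "length ?xs = degree p"
    using size_proots_real_rooted[OF assms(1)]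
    by (metis length_rev mset_sorted_list_of_multiset size_mset)
  have "sorted_wrt (\<ge>) ?xs" by (simp add: sorted_wrt_rev)
  then show ?thesis
    unfolding ordered_root_def using len assms
    by (cases "i = j") (auto simp: sorted_wrt_iff_nth_less simp del: length_rev)
qed

lemma proots_linear_factors: "proots (\<Prod>x\<leftarrow>xs. [:-x, 1:]) = mset (xs :: real list)"
proof (induction xs)
  case (Cons x xs)
  have "(\<Prod>x\<leftarrow>xs. [:-x, 1:]) \<noteq> (0 :: real poly)" by (auto simp: prod_list_zero_iff)
  with Cons show ?case by (simp add: proots_mult del: mult_pCons_left)
qed simp

lemma degree_linear_factors: "degree (\<Prod>x\<leftarrow>xs. [:-x, 1:]) = length (xs :: real list)"
proof (induction xs)
  case (Cons x xs)
  have "(\<Prod>x\<leftarrow>xs. [:-x, 1:]) \<noteq> (0 :: real poly)" by (auto simp: prod_list_zero_iff)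
  with Cons show ?case by (simp add: degree_mult_eq del: mult_pCons_left)
qed simp

lemma real_rooted_linear_factors: "real_rooted (\<Prod>x\<leftarrow>xs. [:-x, 1:])"
proof (induction xs)
  case (Cons x xs)
  have "map_poly (of_real :: real \<Rightarrow> complex) [:-x, 1:] = [:-of_real x, 1:]"
    by (rule poly_eqI, simp add: coeff_map_poly coeff_pCons split: nat.split)
  with Cons show ?case
    by (auto simp: real_rooted_def poly_map_poly_of_real_mult simp del: mult_pCons_left)
qed (simp add: real_rooted_def)

text \<open>A common interlacer exists iff the closed intervals between corresponding roots do not cross.\<close>

lemma common_interlacer_iff:
  assumes "real_rooted p" "real_rooted q" "degree p = n" "degree q = n" "1 \<le> n"
  shows "common_interlacer p q \<longleftrightarrow>
    (\<forall>i\<in>{1..<n}. max (ordered_root p (i + 1)) (ordered_root q (i + 1))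
                   \<le> min (ordered_root p i) (ordered_root q i))"
    (is "_ \<longleftrightarrow> ?R")
proof
  assume "common_interlacer p q"
  then obtain r where "interlaces r p" "interlaces r q" by (auto simp: common_interlacer_def)
  then have deg: "degree r + 1 = n"
    and alt: "\<And>i. i \<in> {1..degree r} \<Longrightarrow>
      ordered_root p (i + 1) \<le> ordered_root r i \<and> ordered_root r i \<le> ordered_root p i \<and>
      ordered_root q (i + 1) \<le> ordered_root r i \<and> ordered_root r i \<le> ordered_root q i"
    using assms by (auto simp: interlaces_def)
  show ?R
  proof
    fix i assume "i \<in> {1..<n}"
    then have "i \<in> {1..degree r}" using deg by auto
    from alt[OF this] show "max (ordered_root p (i + 1)) (ordered_root q (i + 1))
      \<le> min (ordered_root p i) (ordered_root q i)" by linarith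
  qed
next
  assume R: ?R
  define f where "f i = min (ordered_root p i) (ordered_root q i)" for i
  define xs where "xs = map f [1..<n]"
  define r where "r = (\<Prod>x\<leftarrow>xs. [:-x, 1:])"
  have "f j \<le> f i" if "1 \<le> i" "i \<le> j" "j < n" for i j
    using ordered_root_antimono[of p i j] ordered_root_antimono[of q i j] that assms
    by (auto simp: f_def intro: min.mono)
  then have "sorted_wrt (\<ge>) xs"
    by (auto simp: xs_def sorted_wrt_iff_nth_less)
  then have "rev (sorted_list_of_multiset (proots r)) = xs"
    by (rule ordered_root_mset) (simp add: r_def proots_linear_factors)
  then have root: "ordered_root r i = f i" if "1 \<le> i" "i < n" for i
    using that by (simp add: ordered_root_def xs_def)
  have deg: "degree r = n - 1" unfolding r_def degree_linear_factors by (simp add: xs_def)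
  have "real_rooted r" unfolding r_def by (rule real_rooted_linear_factors)
  moreover have "ordered_root p (i + 1) \<le> ordered_root r i \<and> ordered_root r i \<le> ordered_root p i \<and>
      ordered_root q (i + 1) \<le> ordered_root r i \<and> ordered_root r i \<le> ordered_root q i"
    if "i \<in> {1..degree r}" for i
  proof -
    have "1 \<le> i" "i < n" using that deg assms by auto
    with R root[of i] show ?thesis by (auto simp: f_def)
  qed
  ultimately have "interlaces r p \<and> interlaces r q"
    using assms deg by (simp add: interlaces_def)
  then show "common_interlacer p q" unfolding common_interlacer_def by blast
qed

end

theory Submission
  imports Defs
begin

text \<open>Write \<open>r\<^sub>i = p(\<mu>\<^sub>i) / q'(\<mu>\<^sub>i)\<close>, so that \<open>p/q = 1 + \<Sum>\<^sub>i r\<^sub>i / (z - \<mu>\<^sub>i)\<close>, and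
\<open>S\<^sub>k = r\<^sub>1 + \<dots> + r\<^sub>k\<close>; comparing coefficients gives \<open>S\<^sub>n = \<Sum>\<^sub>i \<mu>\<^sub>i - \<Sum>\<^sub>i \<lambda>\<^sub>i = 0\<close>. Suppose that some \<open>S\<^sub>k\<close> with
\<open>1 \<le> k < n\<close> is nonnegative and take \<open>k\<close> with \<open>S\<^sub>k\<close> maximal. Choose \<open>c\<close> separating the first \<open>k\<close> roots of
both polynomials from the others; the common interlacer provides such a \<open>c\<close>, and \<open>p(c)/q(c) > 0\<close>.

Maximality of \<open>S\<^sub>k\<close> says that the sums \<open>r\<^sub>k\<close>, \<open>r\<^sub>k + r\<^sub>k\<^sub>-\<^sub>1\<close>, \<open>\<dots>\<close> are nonnegative and the sums
\<open>r\<^sub>k\<^sub>+\<^sub>1\<close>, \<open>r\<^sub>k\<^sub>+\<^sub>1 + r\<^sub>k\<^sub>+\<^sub>2\<close>, \<open>\<dots>\<close> are nonpositive. In terms of \<open>x\<^sub>i\<close> and \<open>y\<^sub>j\<close>, the distances from \<open>c\<close> of the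
poles on its right and on its left, listed outwards (the residues are renumbered accordingly, and
\<open>\<rho>\<^sub>j\<close> is the negated residue at the \<open>j\<close>-th pole on the left), this reads
\<open>p/q = 1 - (h + g)\<close> with \<open>h = \<Sum>\<^sub>i r\<^sub>i / (x\<^sub>i - t)\<close>, \<open>g = \<Sum>\<^sub>j \<rho>\<^sub>j / (y\<^sub>j + t)\<close>, where \<open>t = z - c\<close> and where both
coefficient sequences have nonnegative partial sums. So \<open>h + g\<close> behaves like the transform of a positive
measure on the line, of total mass \<open>1 - p(c)/q(c) < 1\<close>, and \<open>1 - (h + g)\<close> has a Wiener-Hopf
factorization \<open>(1 - A)(1 - E)\<close> in which \<open>A = \<Sum>\<^sub>i a\<^sub>i / (x\<^sub>i - t)\<close> and \<open>E = \<Sum>\<^sub>j e\<^sub>j / (y\<^sub>j + t)\<close> are positive in the same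
sense. It is found by iterating the equations between residues
\<open>a\<^sub>i = r\<^sub>i + a\<^sub>i E(x\<^sub>i)\<close> and \<open>e\<^sub>j = \<rho>\<^sub>j + e\<^sub>j A(-y\<^sub>j)\<close> from zero, which increases all partial sums
(\<open>factorization_exists\<close>).

As \<open>1 - E > 0\<close> to the right of \<open>c\<close>, the factor \<open>1 - A\<close> vanishes exactly at \<open>\<lambda>\<^sub>1, \<dots>, \<lambda>\<^sub>k\<close>; it is therefore
\<open>(z - \<lambda>\<^sub>1)\<dots>(z - \<lambda>\<^sub>k) / ((z - \<mu>\<^sub>1)\<dots>(z - \<mu>\<^sub>k))\<close>, and its expansion at infinity gives
\<open>\<Sum>\<^sub>i\<^sub>\<le>\<^sub>k (\<mu>\<^sub>i - \<lambda>\<^sub>i) = \<Sum>\<^sub>i a\<^sub>i = S\<^sub>k + \<Sum>\<^sub>i a\<^sub>i E(x\<^sub>i) > 0\<close> (\<open>root_displacement_pos\<close>). This contradicts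
\<open>\<lambda>\<^sub>1 + \<dots> + \<lambda>\<^sub>k \<ge> \<mu>\<^sub>1 + \<dots> + \<mu>\<^sub>k\<close>.\<close>

section \<open>Nonnegative partial sums\<close>

text \<open>This is the discrete notion of positivity used throughout. It is stable under multiplication by
nonnegative nonincreasing weights, although individual terms may be negative; the order on sequences
that it induces (compare all partial sums) is the one in which the iteration below is monotone.\<close>

definition pos_partial_sums :: "nat \<Rightarrow> (nat \<Rightarrow> real) \<Rightarrow> bool" where
  "pos_partial_sums n a \<longleftrightarrow> (\<forall>m\<le>n. 0 \<le> (\<Sum>i<m. a i))"

lemma abel_summation:
  fixes a w :: "nat \<Rightarrow> real"
  shows "(\<Sum>i<m. a i * w i) = (\<Sum>j<m. (\<Sum>i<Suc j. a i) * (w j - w (Suc j))) + (\<Sum>i<m. a i) * w m"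
  by (induction m) (auto simp: algebra_simps)

lemma pos_partial_sums_weighted:
  assumes a: "pos_partial_sums n a"
    and w: "\<And>i. i < n \<Longrightarrow> 0 \<le> w i" and dec: "\<And>i. Suc i < n \<Longrightarrow> w (Suc i) \<le> w i"
  shows "pos_partial_sums n (\<lambda>i. a i * w i)"
  unfolding pos_partial_sums_def
proof (intro allI impI)
  fix m assume m: "m \<le> n"
  show "0 \<le> (\<Sum>i<m. a i * w i)"
  proof (cases m)
    case (Suc l)
    have "0 \<le> (\<Sum>j<l. (\<Sum>i<Suc j. a i) * (w j - w (Suc j)))"
    proof (rule sum_nonneg)
      fix j assume "j \<in> {..<l}"
      then show "0 \<le> (\<Sum>i<Suc j. a i) * (w j - w (Suc j))"
        using m Suc a dec[of j] by (intro mult_nonneg_nonneg) (auto simp: pos_partial_sums_def simp del: sum.lessThan_Suc)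
    qed
    moreover have "0 \<le> (\<Sum>i<Suc l. a i) * w l"
      using m Suc a w by (intro mult_nonneg_nonneg) (auto simp: pos_partial_sums_def simp del: sum.lessThan_Suc)
    moreover have "(\<Sum>i<m. a i * w i) = (\<Sum>j<l. (\<Sum>i<Suc j. a i) * (w j - w (Suc j))) + (\<Sum>i<Suc l. a i) * w l"
      using abel_summation[of a w l] Suc by (simp add: algebra_simps)
    ultimately show ?thesis by linarith
  qed simp
qed

lemma pos_partial_sums_total: "pos_partial_sums n a \<Longrightarrow> 0 \<le> (\<Sum>i<n. a i)"
  by (simp add: pos_partial_sums_def)

lemma pos_partial_sums_trans:
  assumes "pos_partial_sums n r" "pos_partial_sums n (\<lambda>i. a i - r i)"
  shows "pos_partial_sums n a"
  unfolding pos_partial_sums_def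
proof (intro allI impI)
  fix m assume "m \<le> n"
  then have "0 \<le> (\<Sum>i<m. r i)" "0 \<le> (\<Sum>i<m. a i - r i)" using assms by (simp_all add: pos_partial_sums_def)
  then show "0 \<le> (\<Sum>i<m. a i)" by (simp add: sum_subtractf)
qed

text \<open>Lowering the first weight to the value of the second one keeps the weights nonincreasing, so that the
remaining sum is nonnegative; the amount removed contributes a strictly positive multiple of \<open>a 0\<close>.\<close>

lemma weighted_sum_pos:
  assumes a: "pos_partial_sums n a" "0 < n" "0 < a 0"
    and w: "\<And>i. i < n \<Longrightarrow> 0 < w i" and dec: "\<And>i. Suc i < n \<Longrightarrow> w (Suc i) < w i"
  shows "0 < (\<Sum>i<n. a i * w i)"
proof -
  define v where "v = (if 1 < n then w 1 else 0)"
  define w' where "w' = (\<lambda>i. if i = 0 then v else w i)"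
  have "v < w 0" using w[of 0] dec[of 0] \<open>0 < n\<close> by (auto simp: v_def)
  have "pos_partial_sums n (\<lambda>i. a i * w' i)"
    using w less_imp_le[OF dec]
    by (intro pos_partial_sums_weighted[OF a(1)]) (auto simp: w'_def v_def less_imp_le)
  then have "0 \<le> (\<Sum>i<n. a i * w' i)" by (rule pos_partial_sums_total)
  moreover have "(\<Sum>i<n. a i * w i) = (\<Sum>i<n. a i * w' i) + a 0 * (w 0 - v)"
  proof -
    obtain l where "n = Suc l" using \<open>0 < n\<close> by (cases n) auto
    then show ?thesis by (simp add: sum.lessThan_Suc_shift w'_def algebra_simps del: sum.lessThan_Suc)
  qed
  moreover have "0 < a 0 * (w 0 - v)" using \<open>v < w 0\<close> a by simp
  ultimately show ?thesis by linarith
qed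

section \<open>Cauchy transforms of finite sequences\<close>

text \<open>The function \<open>h\<close>, with poles to the right of the origin, is a Cauchy sum evaluated at \<open>-t\<close>, and \<open>g\<close>, with
poles to the left, is one evaluated at \<open>t\<close>. Taking distances from the origin as nodes lets one set of
lemmas serve both sides.\<close>

definition cauchy_sum :: "nat \<Rightarrow> (nat \<Rightarrow> real) \<Rightarrow> (nat \<Rightarrow> real) \<Rightarrow> real \<Rightarrow> real" where
  "cauchy_sum n x a t = (\<Sum>i<n. a i / (x i + t))"

definition increasing_pos :: "nat \<Rightarrow> (nat \<Rightarrow> real) \<Rightarrow> bool" where
  "increasing_pos n x \<longleftrightarrow> (\<forall>i<n. 0 < x i) \<and> (\<forall>i. Suc i < n \<longrightarrow> x i < x (Suc i))"

lemma increasing_pos_pos: "increasing_pos n x \<Longrightarrow> i < n \<Longrightarrow> 0 < x i"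
  by (simp add: increasing_pos_def)

lemma increasing_pos_less: "increasing_pos n x \<Longrightarrow> Suc i < n \<Longrightarrow> x i < x (Suc i)"
  by (simp add: increasing_pos_def)

lemma cauchy_sum_diff:
  "cauchy_sum n x (\<lambda>i. a i - b i) t = cauchy_sum n x a t - cauchy_sum n x b t"
  by (simp add: cauchy_sum_def diff_divide_distrib sum_subtractf)

lemma reciprocal_weight:
  assumes x: "increasing_pos n x" and "0 \<le> t"
  shows "i < n \<Longrightarrow> 0 < 1 / (x i + t)"
    and "Suc i < n \<Longrightarrow> 1 / (x (Suc i) + t) < 1 / (x i + t)"
proof -
  show "0 < 1 / (x i + t)" if "i < n"
    using increasing_pos_pos[OF x that] \<open>0 \<le> t\<close> by simp
  show "1 / (x (Suc i) + t) < 1 / (x i + t)" if "Suc i < n"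
    using increasing_pos_pos[OF x, of i] increasing_pos_less[OF x that] that \<open>0 \<le> t\<close>
    by (simp add: frac_less2)
qed

text \<open>The difference is \<open>(t - s) / ((x i + s) (x i + t))\<close>, whose denominator grows with the node. Hence a
Cauchy sum with nonnegative partial sums is not only nonnegative but also decreasing, and can
itself serve as a weight.\<close>

lemma reciprocal_diff_weight:
  assumes x: "increasing_pos n x" and st: "0 \<le> s" "s < t"
  shows "i < n \<Longrightarrow> 0 < 1 / (x i + s) - 1 / (x i + t)"
    and "Suc i < n \<Longrightarrow> 1 / (x (Suc i) + s) - 1 / (x (Suc i) + t) < 1 / (x i + s) - 1 / (x i + t)"
proof -
  have eq: "1 / (z + s) - 1 / (z + t) = (t - s) / ((z + s) * (z + t))" if "0 < z" for z :: real
  proof -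
    have "z + s \<noteq> 0" "z + t \<noteq> 0" using that st by linarith+
    then show ?thesis by (simp add: divide_simps)
  qed
  show "0 < 1 / (x i + s) - 1 / (x i + t)" if "i < n"
    using increasing_pos_pos[OF x that] st by (simp add: frac_less2)
  show "1 / (x (Suc i) + s) - 1 / (x (Suc i) + t) < 1 / (x i + s) - 1 / (x i + t)" if i: "Suc i < n"
  proof -
    have xi: "0 < x i" "x i < x (Suc i)"
      using increasing_pos_pos[OF x, of i] increasing_pos_less[OF x i] i by auto
    have "(x i + s) * (x i + t) < (x (Suc i) + s) * (x (Suc i) + t)"
      using xi st by (intro mult_strict_mono) auto
    moreover have "0 < (x i + s) * (x i + t)" using xi st by (intro mult_pos_pos) auto
    ultimately show ?thesis
      using st xi eq[of "x i"] eq[of "x (Suc i)"] by (simp add: frac_less2)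
  qed
qed

lemma cauchy_sum_nonneg:
  assumes x: "increasing_pos n x" and a: "pos_partial_sums n a" and t: "0 \<le> t"
  shows "0 \<le> cauchy_sum n x a t"
proof -
  have "pos_partial_sums n (\<lambda>i. a i * (1 / (x i + t)))"
    by (intro pos_partial_sums_weighted[OF a] less_imp_le[OF reciprocal_weight(1)[OF x t]]
        less_imp_le[OF reciprocal_weight(2)[OF x t]])
  from pos_partial_sums_total[OF this] show ?thesis by (simp add: cauchy_sum_def)
qed

lemma cauchy_sum_minus_shift:
  "cauchy_sum n x a s - cauchy_sum n x a t = (\<Sum>i<n. a i * (1 / (x i + s) - 1 / (x i + t)))"
  by (simp add: cauchy_sum_def right_diff_distrib sum_subtractf)

lemma cauchy_sum_antimono:
  assumes x: "increasing_pos n x" and a: "pos_partial_sums n a" and st: "0 \<le> s" "s \<le> t"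
  shows "cauchy_sum n x a t \<le> cauchy_sum n x a s"
proof (cases "s = t")
  case False
  with st have "s < t" by simp
  have "pos_partial_sums n (\<lambda>i. a i * (1 / (x i + s) - 1 / (x i + t)))"
    by (intro pos_partial_sums_weighted[OF a]
        less_imp_le[OF reciprocal_diff_weight(1)[OF x st(1) \<open>s < t\<close>]]
        less_imp_le[OF reciprocal_diff_weight(2)[OF x st(1) \<open>s < t\<close>]])
  from pos_partial_sums_total[OF this] show ?thesis
    unfolding cauchy_sum_minus_shift[symmetric] by simp
qed simp

lemma cauchy_sum_pos:
  assumes x: "increasing_pos n x" and a: "pos_partial_sums n a" "0 < n" "0 < a 0" and t: "0 \<le> t"
  shows "0 < cauchy_sum n x a t"
  using weighted_sum_pos[OF a, where w = "\<lambda>i. 1 / (x i + t)"] reciprocal_weight[OF x t] by (simp add: cauchy_sum_def)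

lemma cauchy_sum_strict_antimono:
  assumes x: "increasing_pos n x" and a: "pos_partial_sums n a" "0 < n" "0 < a 0"
    and st: "0 \<le> s" "s < t"
  shows "cauchy_sum n x a t < cauchy_sum n x a s"
  using weighted_sum_pos[OF a, where w = "\<lambda>i. 1 / (x i + s) - 1 / (x i + t)"] reciprocal_diff_weight[OF x st]
  unfolding cauchy_sum_minus_shift[symmetric] by simp

text \<open>The product of a function with poles on the right and one with poles on the left splits again,
since \<open>1/((x - z)(y + z)) = (1/(x - z) + 1/(y + z)) / (x + y)\<close>; the residue at each pole is the old
residue times the value of the other factor.\<close>

lemma cauchy_sum_mult:
  assumes x: "increasing_pos k x" and y: "increasing_pos l y"
    and "0 \<le> z" "\<And>i. i < k \<Longrightarrow> x i \<noteq> z"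
  shows "cauchy_sum k x a (- z) * cauchy_sum l y e z =
    cauchy_sum k x (\<lambda>i. a i * cauchy_sum l y e (x i)) (- z) +
    cauchy_sum l y (\<lambda>j. e j * cauchy_sum k x a (y j)) z"
proof -
  have *: "a i / (x i + - z) * (e j / (y j + z)) =
      a i * (e j / (y j + x i)) / (x i + - z) + e j * (a i / (x i + y j)) / (y j + z)"
    if "i < k" "j < l" for i j
  proof -
    define d where "d = x i - z"
    define g where "g = y j + z"
    have nz: "d \<noteq> 0" "g \<noteq> 0" "d + g \<noteq> 0"
      using increasing_pos_pos[OF x, of i] increasing_pos_pos[OF y, of j] assms(3,4) that
      by (auto simp: d_def g_def)
    have "a i / d * (e j / g) = a i * (e j / (d + g)) / d + e j * (a i / (d + g)) / g"
      using nz by (simp add: divide_simps) (simp add: algebra_simps)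
    then show ?thesis by (simp add: d_def g_def add.commute)
  qed
  have "cauchy_sum k x a (- z) * cauchy_sum l y e z =
      (\<Sum>i<k. \<Sum>j<l. a i / (x i + - z) * (e j / (y j + z)))"
    unfolding cauchy_sum_def by (rule sum_product)
  also have "\<dots> = (\<Sum>i<k. \<Sum>j<l. a i * (e j / (y j + x i)) / (x i + - z) + e j * (a i / (x i + y j)) / (y j + z))"
    using * by (intro sum.cong refl) auto
  also have "\<dots> = (\<Sum>i<k. \<Sum>j<l. a i * (e j / (y j + x i)) / (x i + - z)) +
      (\<Sum>i<k. \<Sum>j<l. e j * (a i / (x i + y j)) / (y j + z))"
    by (simp add: sum.distrib)
  also have "(\<Sum>i<k. \<Sum>j<l. e j * (a i / (x i + y j)) / (y j + z)) =
      (\<Sum>j<l. \<Sum>i<k. e j * (a i / (x i + y j)) / (y j + z))"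
    by (rule sum.swap)
  finally show ?thesis
    unfolding cauchy_sum_def by (simp add: sum_distrib_left sum_divide_distrib)
qed

section \<open>The factorization\<close>

text \<open>Monotonicity of the nonlinear term: replace first \<open>a\<close> by \<open>a'\<close>, where the weight is the Cauchy sum of
\<open>e\<close>, and then \<open>e\<close> by \<open>e'\<close>, where it is the Cauchy sum of \<open>e' - e\<close>. Both weights are nonnegative and
decrease along the nodes.\<close>

lemma step_mono:
  assumes y: "increasing_pos l y" and x: "increasing_pos k x"
    and "pos_partial_sums k a'" "pos_partial_sums k (\<lambda>i. a' i - a i)"
    and "pos_partial_sums l e" "pos_partial_sums l (\<lambda>j. e' j - e j)"
  shows "pos_partial_sums k (\<lambda>i. a' i * cauchy_sum l y e' (x i) - a i * cauchy_sum l y e (x i))"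
proof -
  have xp: "0 \<le> x i" if "i < k" for i using x that by (auto simp: increasing_pos_def less_imp_le)
  have xi: "x i \<le> x (Suc i)" if "Suc i < k" for i using x that by (auto simp: increasing_pos_def less_imp_le)
  have 1: "pos_partial_sums k (\<lambda>i. (a' i - a i) * cauchy_sum l y e (x i))"
    using assms xp xi by (intro pos_partial_sums_weighted cauchy_sum_nonneg cauchy_sum_antimono) auto
  have 2: "pos_partial_sums k (\<lambda>i. a' i * cauchy_sum l y (\<lambda>j. e' j - e j) (x i))"
    using assms xp xi by (intro pos_partial_sums_weighted cauchy_sum_nonneg cauchy_sum_antimono) auto
  have "(\<Sum>i<m. a' i * cauchy_sum l y e' (x i) - a i * cauchy_sum l y e (x i)) =
     (\<Sum>i<m. (a' i - a i) * cauchy_sum l y e (x i)) + (\<Sum>i<m. a' i * cauchy_sum l y (\<lambda>j. e' j - e j) (x i))" for m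
    unfolding sum.distrib[symmetric] cauchy_sum_diff by (intro sum.cong) (auto simp: algebra_simps)
  with 1 2 show ?thesis by (auto simp: pos_partial_sums_def)
qed

text \<open>Abel summation writes the Cauchy sum as a positive combination of all partial sums, so each of
them is controlled by its own coefficient.\<close>

lemma partial_sum_le_cauchy_sum:
  assumes x: "increasing_pos n x" and m: "0 < m" "m \<le> n"
  shows "\<exists>d>0. \<forall>a. pos_partial_sums n a \<longrightarrow> (\<Sum>i<m. a i) * d \<le> cauchy_sum n x a 0"
proof -
  \<comment> \<open>The value \<open>0\<close> beyond the last node makes the boundary term of Abel summation vanish.\<close>
  define w where "w i = (if i < n then 1 / x i else 0)" for i
  have dec: "w (Suc i) < w i" if "i < n" for i
    using x that by (auto simp: w_def increasing_pos_def intro!: divide_strict_left_mono mult_pos_pos)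
  obtain l where l: "m = Suc l" using m by (cases m) auto
  have "(\<Sum>i<m. a i) * (w l - w (Suc l)) \<le> cauchy_sum n x a 0" if a: "pos_partial_sums n a" for a
  proof -
    have "(\<Sum>i<m. a i) * (w l - w (Suc l)) \<le> (\<Sum>j<n. (\<Sum>i<Suc j. a i) * (w j - w (Suc j)))"
      unfolding l using a dec m l
      by (intro member_le_sum[where f = "\<lambda>j. (\<Sum>i<Suc j. a i) * (w j - w (Suc j))"] mult_nonneg_nonneg)
         (auto simp: pos_partial_sums_def less_imp_le simp del: sum.lessThan_Suc)
    also have "\<dots> = (\<Sum>i<n. a i * w i)" using abel_summation[of a w n] by (simp add: w_def)
    also have "\<dots> = cauchy_sum n x a 0" by (simp add: cauchy_sum_def w_def)
    finally show ?thesis .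
  qed
  moreover have "0 < w l - w (Suc l)" using dec[of l] m l by simp
  ultimately show ?thesis by blast
qed

lemma increasing_bounded_limit:
  assumes x: "increasing_pos n x"
    and pos: "\<And>s. pos_partial_sums n (a s)"
    and inc: "\<And>s. pos_partial_sums n (\<lambda>i. a (Suc s) i - a s i)"
    and bd: "\<And>s. cauchy_sum n x (a s) 0 \<le> B"
  obtains b where "\<And>i. i < n \<Longrightarrow> (\<lambda>s. a s i) \<longlonglongrightarrow> b i"
proof -
  have conv: "convergent (\<lambda>s. \<Sum>i<m. a s i)" if "m \<le> n" for m
  proof (cases "m = 0")
    case False
    have "0 < m" using False by simp
    from partial_sum_le_cauchy_sum[OF x this that] obtain d
      where d: "0 < d" "\<forall>a. pos_partial_sums n a \<longrightarrow> (\<Sum>i<m. a i) * d \<le> cauchy_sum n x a 0"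
      by (elim exE conjE)
    have le: "(\<Sum>i<m. a s i) \<le> B / d" for s
      using d(2)[rule_format, OF pos[of s]] bd[of s] \<open>0 < d\<close> by (simp add: pos_le_divide_eq)
    have ge: "0 \<le> (\<Sum>i<m. a s i)" for s using pos[of s] that by (auto simp: pos_partial_sums_def)
    have "incseq (\<lambda>s. \<Sum>i<m. a s i)"
    proof (rule incseq_SucI)
      fix s
      have "0 \<le> (\<Sum>i<m. a (Suc s) i - a s i)" using inc[of s] that by (auto simp: pos_partial_sums_def)
      then show "(\<Sum>i<m. a s i) \<le> (\<Sum>i<m. a (Suc s) i)" by (simp add: sum_subtractf)
    qed
    moreover have "Bseq (\<lambda>s. \<Sum>i<m. a s i)"
      using le ge by (intro BseqI'[where K = "B / d"]) auto
    ultimately show ?thesis by (intro Bseq_monoseq_convergent) (auto simp: monoseq_iff)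
  qed (simp add: convergent_const)
  have "convergent (\<lambda>s. a s i)" if "i < n" for i
  proof -
    have "convergent (\<lambda>s. (\<Sum>j<Suc i. a s j) - (\<Sum>j<i. a s j))"
      using that by (intro convergent_diff conv) auto
    then show ?thesis by simp
  qed
  then have "\<And>i. i < n \<Longrightarrow> (\<lambda>s. a s i) \<longlonglongrightarrow> lim (\<lambda>s. a s i)" by (simp add: convergent_LIMSEQ_iff)
  then show ?thesis by (rule that)
qed

text \<open>The Wiener-Hopf factorization \<open>1 - h - g = (1 - A)(1 - E)\<close>. By \<open>cauchy_sum_mult\<close>, comparing residues
turns it into the two displayed fixed point equations. Iterating them from zero is increasing by
\<open>step_mono\<close>. At the separating point the values \<open>\<alpha>\<close> of \<open>A\<close> and \<open>\<epsilon>\<close> of \<open>E\<close> are replaced in each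
step by values with sum \<open>N + \<alpha> \<epsilon>\<close>, where \<open>N = h + g < 1\<close> there. Since \<open>\<alpha> \<epsilon> \<le> 1\<close> as long as
\<open>\<alpha> + \<epsilon> \<le> 2\<close>, the sum never exceeds \<open>1 + N\<close>, and the iteration converges. In the limit
\<open>(1 - \<alpha>)(1 - \<epsilon>) = 1 - N > 0\<close>; two negative factors would need \<open>\<alpha> + \<epsilon> > 2\<close>, so both are positive.\<close>

lemma factorization_exists:
  assumes x: "increasing_pos k x" and y: "increasing_pos l y"
    and r: "pos_partial_sums k r" and rho: "pos_partial_sums l \<rho>"
    and less: "cauchy_sum k x r 0 + cauchy_sum l y \<rho> 0 < 1"
  obtains a e where
    "pos_partial_sums k (\<lambda>i. a i - r i)" "pos_partial_sums l (\<lambda>j. e j - \<rho> j)"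
    "\<And>i. i < k \<Longrightarrow> a i = r i + a i * cauchy_sum l y e (x i)"
    "\<And>j. j < l \<Longrightarrow> e j = \<rho> j + e j * cauchy_sum k x a (y j)"
    "cauchy_sum l y e 0 < 1"
proof -
  define st where "st = (\<lambda>(a, e). (\<lambda>i. r i + a i * cauchy_sum l y e (x i), \<lambda>j. \<rho> j + e j * cauchy_sum k x a (y j)))"
  define S where "S s = (st ^^ s) (\<lambda>_. 0, \<lambda>_. 0)" for s
  define a where "a s = fst (S s)" for s
  define e where "e s = snd (S s)" for s
  have a0: "a 0 = (\<lambda>_. 0)" and e0: "e 0 = (\<lambda>_. 0)" by (auto simp: a_def e_def S_def)
  have aS: "a (Suc s) i = r i + a s i * cauchy_sum l y (e s) (x i)"
    and eS: "e (Suc s) j = \<rho> j + e s j * cauchy_sum k x (a s) (y j)" for s i j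
    by (simp_all add: a_def e_def S_def st_def split: prod.split)
  have inv: "pos_partial_sums k (a s) \<and> pos_partial_sums l (e s) \<and>
      pos_partial_sums k (\<lambda>i. a (Suc s) i - a s i) \<and> pos_partial_sums l (\<lambda>i. e (Suc s) i - e s i)" for s
  proof (induction s)
    case 0
    then show ?case using r rho by (simp add: aS eS a0 e0 cauchy_sum_def) (simp add: pos_partial_sums_def)
  next
    case (Suc s)
    have A: "pos_partial_sums k (a (Suc s))" using pos_partial_sums_trans[of k "a s" "a (Suc s)"] Suc by blast
    have E: "pos_partial_sums l (e (Suc s))" using pos_partial_sums_trans[of l "e s" "e (Suc s)"] Suc by blast
    have "a (Suc (Suc s)) i - a (Suc s) i =
       a (Suc s) i * cauchy_sum l y (e (Suc s)) (x i) - a s i * cauchy_sum l y (e s) (x i)" for i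
      by (subst (1 2) aS) simp
    moreover have "e (Suc (Suc s)) i - e (Suc s) i =
       e (Suc s) i * cauchy_sum k x (a (Suc s)) (y i) - e s i * cauchy_sum k x (a s) (y i)" for i
      by (subst (1 2) eS) simp
    ultimately show ?case
      using A E Suc step_mono[OF y x A _ _ , of "a s" "e s" "e (Suc s)"] step_mono[OF x y E _ _ , of "e s" "a s" "a (Suc s)"]
      by simp
  qed
  have ge_r: "pos_partial_sums k (\<lambda>i. a (Suc s) i - r i)" for s
  proof -
    have "pos_partial_sums k (\<lambda>i. a s i * cauchy_sum l y (e s) (x i) - 0 * cauchy_sum l y (\<lambda>_. 0) (x i))"
      using inv[of s] by (intro step_mono[OF y x]) (auto simp: pos_partial_sums_def)
    then show ?thesis by (simp add: aS)
  qed
  have ge_rho: "pos_partial_sums l (\<lambda>i. e (Suc s) i - \<rho> i)" for s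
  proof -
    have "pos_partial_sums l (\<lambda>i. e s i * cauchy_sum k x (a s) (y i) - 0 * cauchy_sum k x (\<lambda>_. 0) (y i))"
      using inv[of s] by (intro step_mono[OF x y]) (auto simp: pos_partial_sums_def)
    then show ?thesis by (simp add: eS)
  qed
  define N where "N = cauchy_sum k x r 0 + cauchy_sum l y \<rho> 0"
  have N: "0 \<le> N" "N < 1"
    using less cauchy_sum_nonneg[OF x r] cauchy_sum_nonneg[OF y rho] by (auto simp: N_def)
  have nn: "0 \<le> cauchy_sum k x (a s) 0" "0 \<le> cauchy_sum l y (e s) 0" for s
    using inv[of s] cauchy_sum_nonneg[OF x] cauchy_sum_nonneg[OF y] by auto
  have bound: "cauchy_sum k x (a s) 0 + cauchy_sum l y (e s) 0 \<le> 1 + N" for s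
  proof (induction s)
    case 0
    then show ?case using N by (simp add: a0 e0 cauchy_sum_def)
  next
    case (Suc s)
    define \<alpha> where "\<alpha> = cauchy_sum k x (a s) 0"
    define \<epsilon> where "\<epsilon> = cauchy_sum l y (e s) 0"
    have "cauchy_sum k x (a s) (- 0) * cauchy_sum l y (e s) 0 =
      cauchy_sum k x (\<lambda>i. a s i * cauchy_sum l y (e s) (x i)) (- 0) +
      cauchy_sum l y (\<lambda>j. e s j * cauchy_sum k x (a s) (y j)) 0"
      using increasing_pos_pos[OF x] by (intro cauchy_sum_mult x y) (auto simp: less_le)
    moreover have "cauchy_sum k x (a (Suc s)) 0 = cauchy_sum k x r 0 + cauchy_sum k x (\<lambda>i. a s i * cauchy_sum l y (e s) (x i)) 0"
      by (simp add: cauchy_sum_def aS add_divide_distrib sum.distrib)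
    moreover have "cauchy_sum l y (e (Suc s)) 0 = cauchy_sum l y \<rho> 0 + cauchy_sum l y (\<lambda>j. e s j * cauchy_sum k x (a s) (y j)) 0"
      by (simp add: cauchy_sum_def eS add_divide_distrib sum.distrib)
    ultimately have "cauchy_sum k x (a (Suc s)) 0 + cauchy_sum l y (e (Suc s)) 0 = N + \<alpha> * \<epsilon>"
      by (simp add: N_def \<alpha>_def \<epsilon>_def)
    moreover have "\<alpha> * \<epsilon> \<le> 1"
    proof -
      have "\<alpha> + \<epsilon> \<le> 2" "0 \<le> \<alpha>" "0 \<le> \<epsilon>" using Suc nn[of s] N by (auto simp: \<alpha>_def \<epsilon>_def)
      then have "(\<alpha> + \<epsilon>)\<^sup>2 \<le> 2\<^sup>2" by (intro power_mono) auto
      moreover have "0 \<le> (\<alpha> - \<epsilon>)\<^sup>2" by simp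
      ultimately show ?thesis by (simp add: power2_eq_square algebra_simps)
    qed
    ultimately show ?case by simp
  qed
  have "cauchy_sum k x (a s) 0 \<le> 1 + N" "cauchy_sum l y (e s) 0 \<le> 1 + N" for s
    using bound[of s] nn[of s] by linarith+
  then obtain b g where b: "\<And>i. i < k \<Longrightarrow> (\<lambda>s. a s i) \<longlonglongrightarrow> b i" and g: "\<And>i. i < l \<Longrightarrow> (\<lambda>s. e s i) \<longlonglongrightarrow> g i"
    using increasing_bounded_limit[OF x, of a "1 + N"] increasing_bounded_limit[OF y, of e "1 + N"] inv by metis
  have limA: "(\<lambda>s. cauchy_sum k x (a s) t) \<longlonglongrightarrow> cauchy_sum k x b t" for t
    unfolding cauchy_sum_def divide_inverse using b by (intro tendsto_sum tendsto_mult_right) auto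
  have limE: "(\<lambda>s. cauchy_sum l y (e s) t) \<longlonglongrightarrow> cauchy_sum l y g t" for t
    unfolding cauchy_sum_def divide_inverse using g by (intro tendsto_sum tendsto_mult_right) auto
  have fixA: "b i = r i + b i * cauchy_sum l y g (x i)" if "i < k" for i
  proof -
    have "(\<lambda>s. a (Suc s) i) \<longlonglongrightarrow> r i + b i * cauchy_sum l y g (x i)"
      unfolding aS by (intro tendsto_intros b that limE)
    with LIMSEQ_Suc[OF b[OF that]] show ?thesis by (rule LIMSEQ_unique)
  qed
  have fixE: "g i = \<rho> i + g i * cauchy_sum k x b (y i)" if "i < l" for i
  proof -
    have "(\<lambda>s. e (Suc s) i) \<longlonglongrightarrow> \<rho> i + g i * cauchy_sum k x b (y i)"
      unfolding eS by (intro tendsto_intros g that limA)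
    with LIMSEQ_Suc[OF g[OF that]] show ?thesis by (rule LIMSEQ_unique)
  qed
  have geA: "pos_partial_sums k (\<lambda>i. b i - r i)"
    unfolding pos_partial_sums_def
  proof (intro allI impI)
    fix m assume m: "m \<le> k"
    have "(\<lambda>s. \<Sum>i<m. a (Suc s) i - r i) \<longlonglongrightarrow> (\<Sum>i<m. b i - r i)"
      using m by (intro tendsto_intros LIMSEQ_Suc b) auto
    then show "0 \<le> (\<Sum>i<m. b i - r i)"
      by (rule LIMSEQ_le_const) (use ge_r m in \<open>auto simp: pos_partial_sums_def\<close>)
  qed
  have geE: "pos_partial_sums l (\<lambda>i. g i - \<rho> i)"
    unfolding pos_partial_sums_def
  proof (intro allI impI)
    fix m assume m: "m \<le> l"
    have "(\<lambda>s. \<Sum>i<m. e (Suc s) i - \<rho> i) \<longlonglongrightarrow> (\<Sum>i<m. g i - \<rho> i)"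
      using m by (intro tendsto_intros LIMSEQ_Suc g) auto
    then show "0 \<le> (\<Sum>i<m. g i - \<rho> i)"
      by (rule LIMSEQ_le_const) (use ge_rho m in \<open>auto simp: pos_partial_sums_def\<close>)
  qed
  define \<alpha> where "\<alpha> = cauchy_sum k x b 0"
  define \<epsilon> where "\<epsilon> = cauchy_sum l y g 0"
  have sum_le: "\<alpha> + \<epsilon> \<le> 1 + N"
    unfolding \<alpha>_def \<epsilon>_def by (rule LIMSEQ_le_const2[OF tendsto_add[OF limA limE]]) (use bound in auto)
  have "\<alpha> * \<epsilon> = cauchy_sum k x (\<lambda>i. b i * cauchy_sum l y g (x i)) (- 0) + cauchy_sum l y (\<lambda>j. g j * cauchy_sum k x b (y j)) 0"
    using cauchy_sum_mult[OF x y, of 0 b g] increasing_pos_pos[OF x] by (auto simp: \<alpha>_def \<epsilon>_def less_le)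
  also have "\<dots> = cauchy_sum k x (\<lambda>i. b i - r i) 0 + cauchy_sum l y (\<lambda>j. g j - \<rho> j) 0"
    unfolding cauchy_sum_def using fixA fixE
    by (intro arg_cong2[where f = "(+)"] sum.cong) (auto simp: cauchy_sum_def algebra_simps)
  also have "\<dots> = \<alpha> + \<epsilon> - N" by (simp add: cauchy_sum_diff \<alpha>_def \<epsilon>_def N_def)
  finally have "(1 - \<alpha>) * (1 - \<epsilon>) = 1 - N" by (simp add: algebra_simps)
  then have "0 < (1 - \<alpha>) * (1 - \<epsilon>)" using N by simp
  then have "\<epsilon> < 1" using sum_le N by (auto simp: zero_less_mult_iff)
  then show ?thesis using that[OF geA geE fixA fixE] by (simp add: \<epsilon>_def)
qed

section \<open>Partial fractions of quotients of monic polynomials\<close>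

text \<open>The numerator of \<open>1 + (\<Sum>i\<in>I. a i / (z - x i))\<close> over the common denominator \<open>\<Prod>i\<in>I. (z - x i)\<close>.\<close>

definition frac_numerator :: "'a set \<Rightarrow> ('a \<Rightarrow> real) \<Rightarrow> ('a \<Rightarrow> real) \<Rightarrow> real poly" where
  "frac_numerator I x a = (\<Prod>i\<in>I. [:- x i, 1:]) + (\<Sum>i\<in>I. smult (a i) (\<Prod>j\<in>I - {i}. [:- x j, 1:]))"

lemma degree_prod_linear: "degree (\<Prod>i\<in>I. [:- x i, 1::real:]) = card I"
  by (subst degree_prod_eq_sum_degree) auto

lemma lead_coeff_prod_linear: "lead_coeff (\<Prod>i\<in>I. [:- x i, 1::real:]) = 1"
  by (simp add: lead_coeff_prod)

lemma coeff_prod_linear_subleading: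
  assumes "finite I" "I \<noteq> {}"
  shows "coeff (\<Prod>i\<in>I. [:- x i, 1::real:]) (card I - 1) = - (\<Sum>i\<in>I. x i)"
  using assms
proof (induction I rule: finite_ne_induct)
  case (insert i I)
  have "coeff (\<Prod>i\<in>I. [:- x i, 1::real:]) (card I) = 1"
    using lead_coeff_prod_linear[of x I] unfolding degree_prod_linear .
  moreover obtain c where "card I = Suc c" using insert by (cases "card I") auto
  ultimately show ?case using insert by (simp add: coeff_pCons)
qed simp

lemma degree_frac_sum_less:
  assumes "finite I" "I \<noteq> {}"
  shows "degree (\<Sum>i\<in>I. smult (a i) (\<Prod>j\<in>I - {i}. [:- x j, 1::real:])) \<le> card I - 1"
proof (intro degree_sum_le assms(1))
  fix i assume "i \<in> I"
  then show "degree (smult (a i) (\<Prod>j\<in>I - {i}. [:- x j, 1::real:])) \<le> card I - 1"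
    using order_trans[OF degree_smult_le] degree_prod_linear[of x "I - {i}"] assms by simp
qed

lemma frac_numerator_degree_coeff:
  assumes "finite I" "I \<noteq> {}"
  shows "degree (frac_numerator I x a) \<le> card I" "coeff (frac_numerator I x a) (card I) = 1"
    "coeff (frac_numerator I x a) (card I - 1) = (\<Sum>i\<in>I. a i) - (\<Sum>i\<in>I. x i)"
proof -
  let ?s = "\<Sum>i\<in>I. smult (a i) (\<Prod>j\<in>I - {i}. [:- x j, 1::real:])"
  have pos: "card I > 0" using assms by (simp add: card_gt_0_iff)
  have d: "degree ?s \<le> card I - 1" by (rule degree_frac_sum_less[OF assms])
  show "degree (frac_numerator I x a) \<le> card I"
    unfolding frac_numerator_def using d by (intro degree_add_le) (auto simp: degree_prod_linear)
  have "coeff ?s (card I) = 0" using d pos by (intro coeff_eq_0) linarith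
  then show "coeff (frac_numerator I x a) (card I) = 1"
    using lead_coeff_prod_linear[of x I] unfolding degree_prod_linear by (simp add: frac_numerator_def)
  have "coeff ?s (card I - 1) = (\<Sum>i\<in>I. a i)"
    unfolding coeff_sum coeff_smult
  proof (intro sum.cong refl)
    fix i assume "i \<in> I"
    then have "card (I - {i}) = card I - 1" using assms by simp
    then show "a i * coeff (\<Prod>j\<in>I - {i}. [:- x j, 1::real:]) (card I - 1) = a i"
      using lead_coeff_prod_linear[of x "I - {i}"] unfolding degree_prod_linear by simp
  qed
  then show "coeff (frac_numerator I x a) (card I - 1) = (\<Sum>i\<in>I. a i) - (\<Sum>i\<in>I. x i)"
    by (simp add: frac_numerator_def coeff_prod_linear_subleading[OF assms, unfolded One_nat_def])
qed

lemma poly_frac_numerator: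
  assumes "finite I" "\<And>i. i \<in> I \<Longrightarrow> z \<noteq> x i"
  shows "poly (frac_numerator I x a) z = (\<Prod>i\<in>I. z - x i) * (1 + (\<Sum>i\<in>I. a i / (z - x i)))"
proof -
  have "(\<Prod>j\<in>I - {i}. z - x j) = (\<Prod>j\<in>I. z - x j) / (z - x i)" if "i \<in> I" for i
    using assms that by (subst prod.remove[of I i]) auto
  then show ?thesis
    by (simp add: frac_numerator_def poly_prod poly_sum sum_distrib_left algebra_simps)
qed

lemma monic_eqI:
  fixes P Q :: "real poly"
  assumes "inj_on z I" "\<And>i. i \<in> I \<Longrightarrow> poly P (z i) = poly Q (z i)"
    and "degree P \<le> card I" "degree Q \<le> card I" "coeff P (card I) = coeff Q (card I)"
  shows "P = Q"
  using assms by (intro poly_eqI_degree_lead_coeff[of P "card I" Q "z ` I"]) (auto simp: card_image)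

text \<open>The numerator is monic with roots \<open>u\<close>, hence equal to \<open>\<Prod>i\<in>I. (z - u i)\<close>; compare the coefficients
next to the leading one.\<close>

lemma sum_residues:
  fixes x u a :: "'a \<Rightarrow> real"
  assumes I: "finite I" "I \<noteq> {}" and "inj_on u I" and ne: "\<And>i l. i \<in> I \<Longrightarrow> l \<in> I \<Longrightarrow> u l \<noteq> x i"
    and zero: "\<And>l. l \<in> I \<Longrightarrow> 1 + (\<Sum>i\<in>I. a i / (u l - x i)) = 0"
  shows "(\<Sum>i\<in>I. a i) = (\<Sum>i\<in>I. x i) - (\<Sum>i\<in>I. u i)"
proof -
  have "frac_numerator I x a = (\<Prod>i\<in>I. [:- u i, 1:])"
  proof (rule monic_eqI[OF \<open>inj_on u I\<close>])
    fix l assume l: "l \<in> I"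
    show "poly (frac_numerator I x a) (u l) = poly (\<Prod>i\<in>I. [:- u i, 1:]) (u l)"
      using poly_frac_numerator[OF I(1), of "u l" x a] ne[OF _ l] zero[OF l] l I by (auto simp: poly_prod)
  qed (use frac_numerator_degree_coeff[OF I] lead_coeff_prod_linear[of u I] in \<open>auto simp: degree_prod_linear\<close>)
  then show ?thesis
    using frac_numerator_degree_coeff(3)[OF I, of x a] coeff_prod_linear_subleading[OF I, of u] by simp
qed

text \<open>Lagrange interpolation: with these residues the numerator of the right-hand side agrees with the
monic polynomial \<open>P\<close> at all nodes, and it is monic of the same degree.\<close>

lemma partial_fractions:
  fixes P :: "real poly" and x :: "'a \<Rightarrow> real"
  assumes I: "finite I" "I \<noteq> {}" and inj: "inj_on x I"
    and P: "lead_coeff P = 1" "degree P = card I" and Q: "Q = (\<Prod>i\<in>I. [:- x i, 1:])"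
    and z: "\<And>i. i \<in> I \<Longrightarrow> z \<noteq> x i"
  shows "poly P z / poly Q z = 1 + (\<Sum>i\<in>I. poly P (x i) / poly (pderiv Q) (x i) / (z - x i))"
proof -
  define a where "a i = poly P (x i) / poly (pderiv Q) (x i)" for i
  have others: "poly (\<Prod>j\<in>I - {i}. [:- x j, 1:]) (x l) = 0" if "i \<noteq> l" "l \<in> I" for i l
    using that I by (auto simp: poly_prod)
  have Q': "poly (pderiv Q) (x l) = poly (\<Prod>j\<in>I - {l}. [:- x j, 1:]) (x l)" if "l \<in> I" for l
  proof -
    have "poly (pderiv Q) (x l) = (\<Sum>i\<in>I. poly (\<Prod>j\<in>I - {i}. [:- x j, 1:]) (x l))"
      unfolding Q pderiv_prod by (simp add: poly_sum pderiv_pCons)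
    also have "\<dots> = (\<Sum>i\<in>I. if i = l then poly (\<Prod>j\<in>I - {l}. [:- x j, 1:]) (x l) else 0)"
      using others that by (intro sum.cong) auto
    finally show ?thesis using that I by simp
  qed
  have nz: "poly (pderiv Q) (x l) \<noteq> 0" if "l \<in> I" for l
    unfolding Q'[OF that] using inj that I by (auto simp: poly_prod inj_on_def)
  have "P = frac_numerator I x a"
  proof (rule monic_eqI[OF inj])
    fix l assume l: "l \<in> I"
    have "poly (frac_numerator I x a) (x l) = (\<Sum>i\<in>I. a i * poly (\<Prod>j\<in>I - {i}. [:- x j, 1:]) (x l))"
      using l I by (auto simp: frac_numerator_def poly_sum poly_prod)
    also have "\<dots> = (\<Sum>i\<in>I. if i = l then a l * poly (\<Prod>j\<in>I - {l}. [:- x j, 1:]) (x l) else 0)"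
      using others l by (intro sum.cong) auto
    also have "\<dots> = poly P (x l)" using l I Q'[OF l] nz[OF l] by (simp add: a_def)
    finally show "poly P (x l) = poly (frac_numerator I x a) (x l)" by simp
  qed (use frac_numerator_degree_coeff[OF I] P in auto)
  moreover have "poly Q z = (\<Prod>i\<in>I. z - x i)" "poly Q z \<noteq> 0"
    using I z by (auto simp: Q poly_prod)
  ultimately show ?thesis using poly_frac_numerator[OF I(1) z, where a = a] by (simp add: a_def)
qed

section \<open>The inequality\<close>

text \<open>The nodes \<open>x\<close> and \<open>y\<close> are the poles on both sides of the origin, and the points \<open>u\<close> are the zeros of
the function \<open>1 - h - g\<close> on the right. They are zeros of the right factor \<open>1 - A\<close> because the left one is
positive there, so \<open>(\<Sum>i<k. x i) - (\<Sum>i<k. u i)\<close> is the sum of the \<open>a i\<close>. The latter exceeds the sum of the \<open>r i\<close>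
by the sum of the \<open>a i\<close> weighted with values of \<open>E\<close>, which is positive.\<close>

lemma root_displacement_pos:
  assumes x: "increasing_pos k x" and y: "increasing_pos l y" and "0 < k" "0 < l"
    and r: "pos_partial_sums k r" "0 < r 0" and rho: "pos_partial_sums l \<rho>" "0 < \<rho> 0"
    and less: "cauchy_sum k x r 0 + cauchy_sum l y \<rho> 0 < 1"
    and u: "inj_on u {..<k}" "\<And>m. m < k \<Longrightarrow> 0 < u m" "\<And>i m. i < k \<Longrightarrow> m < k \<Longrightarrow> u m \<noteq> x i"
    and zero: "\<And>m. m < k \<Longrightarrow> cauchy_sum k x r (- u m) + cauchy_sum l y \<rho> (u m) = 1"
  shows "(\<Sum>i<k. u i) < (\<Sum>i<k. x i)"
proof -
  obtain a e where a: "pos_partial_sums k (\<lambda>i. a i - r i)" and e: "pos_partial_sums l (\<lambda>j. e j - \<rho> j)"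
    and fixA: "\<And>i. i < k \<Longrightarrow> a i = r i + a i * cauchy_sum l y e (x i)"
    and fixE: "\<And>j. j < l \<Longrightarrow> e j = \<rho> j + e j * cauchy_sum k x a (y j)"
    and E1: "cauchy_sum l y e 0 < 1"
    using factorization_exists[OF x y r(1) rho(1) less] by blast
  have a_ge: "(\<Sum>i<m. r i) \<le> (\<Sum>i<m. a i)" if "m \<le> k" for m
    using a that by (auto simp: pos_partial_sums_def sum_subtractf)
  have e_ge: "(\<Sum>i<m. \<rho> i) \<le> (\<Sum>i<m. e i)" if "m \<le> l" for m
    using e that by (auto simp: pos_partial_sums_def sum_subtractf)
  have cone_a: "pos_partial_sums k a" by (rule pos_partial_sums_trans[OF r(1) a])
  have cone_e: "pos_partial_sums l e" by (rule pos_partial_sums_trans[OF rho(1) e])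
  have a0: "0 < a 0" using a_ge[of 1] r(2) \<open>0 < k\<close> by simp
  have e0: "0 < e 0" using e_ge[of 1] rho(2) \<open>0 < l\<close> by simp
  have "1 + (\<Sum>i<k. a i / (u m - x i)) = 0" if m: "m < k" for m
  proof -
    let ?A = "cauchy_sum k x a (- u m)" and ?E = "cauchy_sum l y e (u m)"
    have "?A * ?E = cauchy_sum k x (\<lambda>i. a i * cauchy_sum l y e (x i)) (- u m) +
        cauchy_sum l y (\<lambda>j. e j * cauchy_sum k x a (y j)) (u m)"
      using u(2)[OF m] u(3)[OF _ m] by (intro cauchy_sum_mult x y) (auto dest: not_sym)
    also have "\<dots> = cauchy_sum k x (\<lambda>i. a i - r i) (- u m) + cauchy_sum l y (\<lambda>j. e j - \<rho> j) (u m)"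
      unfolding cauchy_sum_def using fixA fixE
      by (intro arg_cong2[where f = "(+)"] sum.cong) (auto simp: cauchy_sum_def algebra_simps)
    also have "\<dots> = ?A + ?E - 1" using zero[OF m] by (simp add: cauchy_sum_diff)
    finally have "(1 - ?A) * (1 - ?E) = 0" by (simp add: algebra_simps)
    moreover have "?E < 1"
      using cauchy_sum_antimono[OF y cone_e, of 0 "u m"] u(2)[OF m] E1 by simp
    ultimately have "?A = 1" by simp
    moreover have "?A = - (\<Sum>i<k. a i / (u m - x i))"
      unfolding cauchy_sum_def sum_negf[symmetric]
      by (intro sum.cong refl) (metis add.commute minus_diff_eq minus_divide_right uminus_add_conv_diff)
    ultimately show ?thesis by simp
  qed
  then have "(\<Sum>i<k. a i) = (\<Sum>i<k. x i) - (\<Sum>i<k. u i)"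
    using u \<open>0 < k\<close> by (intro sum_residues) auto
  moreover have "0 < (\<Sum>i<k. a i * cauchy_sum l y e (x i))"
    using x \<open>0 < k\<close> \<open>0 < l\<close> a0 e0 cone_a cone_e
    by (intro weighted_sum_pos cauchy_sum_pos[OF y] cauchy_sum_strict_antimono[OF y])
       (auto simp: increasing_pos_def less_imp_le)
  moreover have "(\<Sum>i<k. a i) = (\<Sum>i<k. r i) + (\<Sum>i<k. a i * cauchy_sum l y e (x i))"
    unfolding sum.distrib[symmetric] using fixA by (intro sum.cong) auto
  moreover have "0 \<le> (\<Sum>i<k. r i)" by (rule pos_partial_sums_total[OF r(1)])
  ultimately show ?thesis by linarith
qed

section \<open>Ordered roots\<close>

lemma ordered_roots_simple:
  assumes "real_rooted p" "rsquarefree p" "degree p = n"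
  shows "\<And>i. i \<in> {1..n} \<Longrightarrow> poly p (ordered_root p i) = 0"
    and "\<And>i j. 1 \<le> i \<Longrightarrow> i < j \<Longrightarrow> j \<le> n \<Longrightarrow> ordered_root p j < ordered_root p i"
proof -
  define xs where "xs = rev (sorted_list_of_multiset (proots p))"
  have nz: "p \<noteq> 0" by (rule real_rooted_nonzero[OF assms(1)])
  have mset: "mset xs = proots p" by (simp add: xs_def)
  have len: "length xs = n"
    using size_proots_real_rooted[OF assms(1)] assms(3) by (metis mset size_mset)
  have set: "set xs = {x. poly p x = 0}"
    using nz mset by (metis set_count_proots set_mset_mset)
  have root: "ordered_root p i = xs ! (i - 1)" for i by (simp add: ordered_root_def xs_def)
  show "poly p (ordered_root p i) = 0" if "i \<in> {1..n}" for i
  proof -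
    have "xs ! (i - 1) \<in> set xs" using that len by (intro nth_mem) auto
    then show ?thesis by (simp add: root set)
  qed
  have "distinct xs"
    unfolding distinct_count_atmost_1
  proof
    fix a
    have "count (mset xs) a = order a p" using nz by (simp add: mset)
    moreover have "order a p = 0 \<or> order a p = 1" using assms(2) by (simp add: rsquarefree_def)
    moreover have "poly p a = 0 \<longleftrightarrow> order a p \<noteq> 0" using nz by (simp add: order_root)
    ultimately show "count (mset xs) a = (if a \<in> set xs then 1 else 0)" by (auto simp: set)
  qed
  then show "ordered_root p j < ordered_root p i" if "1 \<le> i" "i < j" "j \<le> n" for i j
  proof -
    have "xs ! (j - 1) \<noteq> xs ! (i - 1)"
      using \<open>distinct xs\<close> that len by (subst nth_eq_iff_index_eq) auto
    moreover have "ordered_root p j \<le> ordered_root p i"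
      using ordered_root_antimono[OF assms(1), of i j] that assms(3) by simp
    ultimately show ?thesis by (simp add: root)
  qed
qed

lemma ordered_roots_inj:
  assumes "real_rooted p" "rsquarefree p" "degree p = n"
  shows "inj_on (ordered_root p) {1..n}"
proof (rule linorder_inj_onI')
  fix i j assume "i \<in> {1..n}" "j \<in> {1..n}" "i < j"
  then show "ordered_root p i \<noteq> ordered_root p j"
    using ordered_roots_simple(2)[OF assms, of i j] by simp
qed

lemma monic_eq_prod_ordered_roots:
  assumes "real_rooted p" "rsquarefree p" "degree p = n" "lead_coeff p = 1"
  shows "p = (\<Prod>i\<in>{1..n}. [:- ordered_root p i, 1:])"
proof (rule monic_eqI[OF ordered_roots_inj[OF assms(1-3)]])
  fix i assume i: "i \<in> {1..n}"
  then show "poly p (ordered_root p i) = poly (\<Prod>i\<in>{1..n}. [:- ordered_root p i, 1:]) (ordered_root p i)"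
    using ordered_roots_simple(1)[OF assms(1-3) i] by (auto simp: poly_prod)
next
  show "coeff p (card {1..n}) = coeff (\<Prod>i\<in>{1..n}. [:- ordered_root p i, 1:]) (card {1..n})"
    using lead_coeff_prod_linear[of "ordered_root p" "{1..n}"] assms(3,4)
    unfolding degree_prod_linear by simp
qed (use assms in \<open>auto simp: degree_prod_linear\<close>)

text \<open>Both parts are enumerated starting next to the cut between \<open>k\<close> and \<open>k + 1\<close>.\<close>

lemma sum_split_outward:
  fixes g :: "nat \<Rightarrow> real"
  assumes "k \<le> n"
  shows "(\<Sum>i=1..n. g i) = (\<Sum>i<k. g (k - i)) + (\<Sum>j<n - k. g (k + 1 + j))"
proof -
  have up: "(\<Sum>i=1..k + m. g i) = (\<Sum>i=1..k. g i) + (\<Sum>j<m. g (k + 1 + j))" for m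
    by (induction m) simp_all
  have down: "(\<Sum>i=1..k. g i) = (\<Sum>i<k. g (k - i))"
    by (intro sum.reindex_bij_witness[where i = "\<lambda>i. k - i" and j = "\<lambda>i. k - i"]) auto
  show ?thesis using up[of "n - k"] assms down by simp
qed

theorem theorem2p2:
  fixes p q :: "real poly" and n :: nat
  assumes "lead_coeff p = 1" and "lead_coeff q = 1"
    and "degree p = n" and "degree q = n"
    and "real_rooted p" and "real_rooted q"
    and "rsquarefree p" and "rsquarefree q"
    and "common_interlacer p q"
    and "\<forall>x. \<not> (poly p x = 0 \<and> poly q x = 0)"
    and "poly_majorizes p q"
  shows "\<forall>k. 1 \<le> k \<and> k < n \<longrightarrow>
    (\<Sum>i=1..k. poly p (ordered_root q i) / poly (pderiv q) (ordered_root q i)) < 0"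
proof (rule ccontr)
  define la where "la = ordered_root p"
  define mu where "mu = ordered_root q"
  define res where "res i = poly p (mu i) / poly (pderiv q) (mu i)" for i
  define S where "S m = (\<Sum>i=1..m. res i)" for m
  assume "\<not> ?thesis"
  then obtain k0 where k0: "k0 \<in> {1..<n}" "0 \<le> S k0"
    by (auto simp: S_def res_def mu_def not_less)
  have maj: "\<And>m. m \<in> {1..n} \<Longrightarrow> (\<Sum>i=1..m. mu i) \<le> (\<Sum>i=1..m. la i)"
    and maj_total: "(\<Sum>i=1..n. la i) = (\<Sum>i=1..n. mu i)"
    using assms(3,11) by (auto simp: poly_majorizes_def majorizes_def la_def mu_def)
  have la_root: "poly p (la i) = 0" if "i \<in> {1..n}" for i
    using ordered_roots_simple(1)[OF assms(5,7,3) that] by (simp add: la_def)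
  have mu_root: "poly q (mu i) = 0" if "i \<in> {1..n}" for i
    using ordered_roots_simple(1)[OF assms(6,8,4) that] by (simp add: mu_def)
  have la_less: "la j < la i" if "1 \<le> i" "i < j" "j \<le> n" for i j
    using ordered_roots_simple(2)[OF assms(5,7,3) that] by (simp add: la_def)
  have mu_less: "mu j < mu i" if "1 \<le> i" "i < j" "j \<le> n" for i j
    using ordered_roots_simple(2)[OF assms(6,8,4) that] by (simp add: mu_def)
  have la_inj: "inj_on la {1..n}" and mu_inj: "inj_on mu {1..n}"
    using ordered_roots_inj[OF assms(5,7,3)] ordered_roots_inj[OF assms(6,8,4)] by (simp_all add: la_def mu_def)
  have p: "p = (\<Prod>i\<in>{1..n}. [:- la i, 1:])"
    using monic_eq_prod_ordered_roots[OF assms(5,7,3,1)] by (simp add: la_def)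
  have q: "q = (\<Prod>i\<in>{1..n}. [:- mu i, 1:])"
    using monic_eq_prod_ordered_roots[OF assms(6,8,4,2)] by (simp add: mu_def)
  have ne: "la i \<noteq> mu j" if "i \<in> {1..n}" "j \<in> {1..n}" for i j
    using la_root[OF that(1)] mu_root[OF that(2)] assms(10) by metis
  have ne_empty: "{1..n} \<noteq> {}" using k0 by auto
  have quotient: "poly p z / poly q z = 1 + (\<Sum>i=1..n. res i / (z - mu i))"
    if "\<And>i. i \<in> {1..n} \<Longrightarrow> z \<noteq> mu i" for z
    unfolding res_def using assms(1,3) ne_empty that
    by (intro partial_fractions mu_inj q) auto
  have "S n = 0"
  proof -
    have "(\<Sum>i=1..n. res i) = (\<Sum>i=1..n. mu i) - (\<Sum>i=1..n. la i)"
    proof (rule sum_residues[OF _ ne_empty la_inj])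
      fix m assume m: "m \<in> {1..n}"
      show "1 + (\<Sum>i=1..n. res i / (la m - mu i)) = 0"
        using quotient[of "la m"] ne[OF m] la_root[OF m] by simp
    qed (use ne in auto)
    then show ?thesis using maj_total by (simp add: S_def)
  qed
  \<comment> \<open>At a maximal partial sum, all sums of residues from \<open>k\<close> back towards \<open>1\<close> are nonnegative and all sums
     from \<open>k + 1\<close> on towards \<open>n\<close> are nonpositive.\<close>
  obtain k where k: "k \<in> {1..<n}" and k_max: "\<And>j. j \<in> {1..<n} \<Longrightarrow> S j \<le> S k"
  proof -
    have "Max (S ` {1..<n}) \<in> S ` {1..<n}" using k0 by (intro Max_in) auto
    then obtain k where "k \<in> {1..<n}" "Max (S ` {1..<n}) = S k" by auto
    moreover have "S j \<le> Max (S ` {1..<n})" if "j \<in> {1..<n}" for j using that by (intro Max_ge) auto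
    ultimately show thesis using that by metis
  qed
  have S_le: "S j \<le> S k" if "j \<le> n" for j
  proof -
    have "0 \<le> S k" using k0 k_max by fastforce
    moreover have "S 0 = 0" by (simp add: S_def)
    ultimately show ?thesis
      using k_max[of j] \<open>S n = 0\<close> that by (cases "j = 0"; cases "j = n") auto
  qed
  \<comment> \<open>The interlacing inequality is strict here, because the four roots involved are distinct.\<close>
  obtain c where c: "la (k + 1) < c" "mu (k + 1) < c" "c < la k" "c < mu k"
  proof -
    have "max (la (k + 1)) (mu (k + 1)) \<le> min (la k) (mu k)"
      using common_interlacer_iff[OF assms(5,6,3,4)] assms(9) k by (auto simp: la_def mu_def)
    moreover have "la (k + 1) < la k" "mu (k + 1) < mu k"
      using k by (auto intro: la_less mu_less)
    moreover have "la (k + 1) \<noteq> mu k" "la k \<noteq> mu (k + 1)" 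
      using ne[of "k + 1" k] ne[of k "k + 1"] k by simp_all
    ultimately have "max (la (k + 1)) (mu (k + 1)) < min (la k) (mu k)" by linarith
    from dense[OF this] show thesis using that by auto
  qed
  have upper: "c < la i" "c < mu i" if "1 \<le> i" "i \<le> k" for i
    using that c k la_less[of i k] mu_less[of i k] by (cases "i = k"; fastforce)+
  have lower: "la i < c" "mu i < c" if "k < i" "i \<le> n" for i
    using that c k la_less[of "k + 1" i] mu_less[of "k + 1" i] by (cases "i = k + 1"; fastforce)+
  have "0 < poly p c / poly q c"
  proof -
    have "poly p c / poly q c = (\<Prod>i=1..n. (c - la i) / (c - mu i))"
      by (subst p, subst q) (simp add: poly_prod prod_dividef)
    also have "\<dots> > 0"
    proof (rule prod_pos)
      fix i assume "i \<in> {1..n}"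
      then show "0 < (c - la i) / (c - mu i)"
        using upper[of i] lower[of i] by (cases "i \<le> k") (auto intro: divide_neg_neg)
    qed
    finally show ?thesis .
  qed

  \<comment> \<open>Move \<open>c\<close> to the origin and list poles, residues and roots outwards from it; the sign in \<open>\<rho>\<close> makes
     both coefficient sequences positive in the sense of partial sums.\<close>
  define l where "l = n - k"
  define x where "x i = mu (k - i) - c" for i
  define y where "y j = c - mu (k + 1 + j)" for j
  define u where "u i = la (k - i) - c" for i
  define r where "r i = res (k - i)" for i
  define \<rho> where "\<rho> j = - res (k + 1 + j)" for j
  have split: "poly p z / poly q z = 1 - cauchy_sum k x r (- (z - c)) - cauchy_sum l y \<rho> (z - c)"
    if "\<And>i. i \<in> {1..n} \<Longrightarrow> z \<noteq> mu i" for z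
  proof -
    have "cauchy_sum k x r (- (z - c)) = - (\<Sum>i<k. res (k - i) / (z - mu (k - i)))"
      unfolding cauchy_sum_def sum_negf[symmetric] x_def r_def
      by (intro sum.cong refl) (simp add: minus_divide_right)
    moreover have "cauchy_sum l y \<rho> (z - c) = - (\<Sum>j<l. res (k + 1 + j) / (z - mu (k + 1 + j)))"
      unfolding cauchy_sum_def sum_negf[symmetric] y_def \<rho>_def by (intro sum.cong refl) simp
    ultimately show ?thesis
      using quotient[OF that] sum_split_outward[of k n "\<lambda>i. res i / (z - mu i)"] k by (simp add: l_def)
  qed
  have x: "increasing_pos k x"
    using k by (auto simp: increasing_pos_def x_def intro!: upper mu_less)
  have y: "increasing_pos l y"
    using k by (auto simp: increasing_pos_def y_def l_def intro!: lower mu_less)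
  have r_sum: "(\<Sum>i<m. r i) = S k - S (k - m)" if "m \<le> k" for m
    using that
  proof (induction m)
    case (Suc m)
    then have "k - m = Suc (k - Suc m)" by simp
    then have "S (k - m) = S (k - Suc m) + res (k - m)" by (simp add: S_def)
    with Suc show ?case by (simp add: r_def)
  qed simp
  have rho_sum: "(\<Sum>j<m. \<rho> j) = S k - S (k + m)" for m
    by (induction m) (simp_all add: \<rho>_def S_def)
  have r: "pos_partial_sums k r"
    using S_le k by (auto simp: pos_partial_sums_def r_sum)
  have rho: "pos_partial_sums l \<rho>"
    using S_le k by (auto simp: pos_partial_sums_def rho_sum l_def)
  have res_nz: "res i \<noteq> 0" if "i \<in> {1..n}" for i
    using mu_root[OF that] assms(8,10) unfolding rsquarefree_roots res_def by auto
  have kn: "1 \<le> k" "k - 1 \<le> n" "k + 1 \<le> n" "k \<in> {1..n}" "k + 1 \<in> {1..n}" using k by auto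
  have "0 < r 0"
    using r_sum[of 1] S_le[OF kn(2)] res_nz[OF kn(4)] kn(1) by (simp add: r_def)
  have "0 < \<rho> 0"
    using rho_sum[of 1] S_le[OF kn(3)] res_nz[OF kn(5)] by (simp add: \<rho>_def)
  have "(\<Sum>i<k. u i) < (\<Sum>i<k. x i)"
  proof (rule root_displacement_pos[OF x y _ _ r \<open>0 < r 0\<close> rho \<open>0 < \<rho> 0\<close>])
    show "0 < k" "0 < l" using k by (auto simp: l_def)
    have "c \<noteq> mu i" if "i \<in> {1..n}" for i
      using upper[of i] lower[of i] that by (cases "i \<le> k") auto
    from split[OF this] show "cauchy_sum k x r 0 + cauchy_sum l y \<rho> 0 < 1"
      using \<open>0 < poly p c / poly q c\<close> by simp
    show "inj_on u {..<k}"
    proof (rule inj_onI)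
      fix i j assume ij: "i \<in> {..<k}" "j \<in> {..<k}" "u i = u j"
      then have "k - i = k - j" using k by (intro inj_onD[OF la_inj]) (auto simp: u_def)
      then show "i = j" using ij by auto
    qed
    show "0 < u m" if "m < k" for m using upper[of "k - m"] that by (simp add: u_def)
    show "u m \<noteq> x i" if "i < k" "m < k" for i m
    proof -
      have "k - m \<in> {1..n}" "k - i \<in> {1..n}" using that k by auto
      from ne[OF this] show ?thesis by (simp add: u_def x_def)
    qed
    show "cauchy_sum k x r (- u m) + cauchy_sum l y \<rho> (u m) = 1" if "m < k" for m
    proof -
      have m: "k - m \<in> {1..n}" using that k by auto
      show ?thesis
        using split[OF ne[OF m]] la_root[OF m] by (simp add: u_def)
    qed
  qed
  then have "(\<Sum>i<k. la (k - i)) < (\<Sum>i<k. mu (k - i))"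
    by (simp add: u_def x_def sum_subtractf)
  then have "(\<Sum>i=1..k. la i) < (\<Sum>i=1..k. mu i)"
    using sum_split_outward[of k k la] sum_split_outward[of k k mu] by simp
  then show False using maj[of k] k by auto
qed

end
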